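(* Let $n\geqslant 2$, $\lambda>0$ and $p,r\in(0,1)$ satisfy $$\frac{n-1}{n}\,\frac1p+\frac1r-\frac{\lambda}{n}=2-\frac1n .$$ Then there exists a best (that is, largest possible) constant $C^+>0$, depending only on $n,\lambda$ and $p$, such that for all nonnegative functions $f\in L^p(\partial\mathbb{R}^n_+)$ and $g\in L^r(\mathbb{R}^n_+)$, $$\int_{\mathbb{R}^n_+}\int_{\partial\mathbb{R}^n_+} f(x)\,|x-y|^\lambda\, g(y)\,dx\,dy\ \geqslant\ C^+\Big(\int_{\partial\mathbb{R}^n_+}|f|^p\,dx\Big)^{1/p}\Big(\int_{\mathbb{R}^n_+}|g|^r\,dy\Big)^{1/r}.$$
   Context: $\mathbb{R}^n_+=\{y=(y',y_n)\in\mathbb{R}^n: y'\in\mathbb{R}^{n-1},\ y_n>0\}$, and its boundary $\partial\mathbb{R}^n_+$ is identified with $\mathbb{R}^{n-1}$ (with $(n-1)$-dimensional Lebesgue measure $dx$); for $x\in\partial\mathbb{R}^n_+$ and $y=(y',y_n)\in\mathbb{R}^n_+$, $|x-y|=\sqrt{|y'-x|^2+y_n^2}$. For $0<\vartheta<1$, $\phi\in L^\vartheta(\Omega)$ means that $\phi$ is measurable with $\int_\Omega|\phi|^\vartheta<+\infty$. The left-hand side is allowed to be $+\infty$. *)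

theory Defs
  imports "HOL-Analysis.Analysis"
begin

text \<open>
  \<open>\<real>\<^sup>n\<close> is split as \<open>real^'m \<times> real\<close> with \<open>CARD('m) = n - 1\<close>, so a point is a pair
  \<open>(y', y\<^sub>n)\<close>. The norm of the product type is the Euclidean one, and \<open>lebesgue\<close> on the
  product type is \<open>n\<close>-dimensional Lebesgue measure. The boundary of the half-space is
  identified with \<open>real^'m\<close> via \<open>x \<mapsto> (x, 0)\<close>.
\<close>

definition half_space :: "((real^'m::finite) \<times> real) set" where
  "half_space = {y. snd y > 0}"

text \<open>
  The elements are functions, not functions modulo null sets. With
  \<open>M = lebesgue_on S\<close> only the values on \<open>S\<close> matter.
\<close>

definition Lspace :: "'a measure \<Rightarrow> real \<Rightarrow> ('a \<Rightarrow> real) set" where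
  "Lspace M \<theta> = {f \<in> borel_measurable M. (\<integral>\<^sup>+x. ennreal (\<bar>f x\<bar> powr \<theta>) \<partial>M) < \<infinity>}"

definition Lqnorm :: "'a measure \<Rightarrow> real \<Rightarrow> ('a \<Rightarrow> real) \<Rightarrow> real" where
  "Lqnorm M \<theta> f = (\<integral>x. \<bar>f x\<bar> powr \<theta> \<partial>M) powr (1 / \<theta>)"

text \<open>The values are in \<open>ennreal\<close> because the integral may be infinite.\<close>

definition HLS_form ::
  "real \<Rightarrow> (real^'m::finite \<Rightarrow> real) \<Rightarrow> ((real^'m) \<times> real \<Rightarrow> real) \<Rightarrow> ennreal" where
  "HLS_form lam f g =
     (\<integral>\<^sup>+y. (\<integral>\<^sup>+x. ennreal (f x * norm ((x, 0) - y) powr lam * g y) \<partial>lebesgue)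
        \<partial>(lebesgue_on half_space))"

definition reverse_HLS_constant ::
  "'m::finite itself \<Rightarrow> real \<Rightarrow> real \<Rightarrow> real \<Rightarrow> real \<Rightarrow> bool" where
  "reverse_HLS_constant TYPE('m) lam p r C \<longleftrightarrow>
     (\<forall>(f :: real^'m \<Rightarrow> real) \<in> Lspace lebesgue p.
      \<forall>(g :: (real^'m) \<times> real \<Rightarrow> real) \<in> Lspace (lebesgue_on half_space) r.
        (\<forall>x. f x \<ge> 0) \<longrightarrow> (\<forall>y\<in>half_space. g y \<ge> 0) \<longrightarrow>
        HLS_form lam f g
          \<ge> ennreal (C * Lqnorm lebesgue p f * Lqnorm (lebesgue_on half_space) r g))"

end

theory Submission imports Defs begin

text \<open>
  Put \<open>a = (n - 1) (1/p - 1)\<close> and \<open>b = n (1/r - 1)\<close>, so that the scaling condition reads \<open>a + b = \<lambda>\<close>.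
  Let \<open>I\<close> be the value of the form, \<open>F = \<integral>f\<close> and \<open>G = \<integral>g\<close>. Averaging gives centres \<open>x0\<close> and \<open>y0\<close>
  with \<open>\<integral>|x0 - y|\<^sup>\<lambda> g(y) dy \<le> 2I/F\<close> and \<open>\<integral>|x - y0|\<^sup>\<lambda> f(x) dx \<le> 2I/G\<close>. A Carlson-type inequality
  bounds the \<open>L\<^sup>r\<close> quasi-norm of \<open>g\<close> by a multiple of \<open>G (M/G)\<^bsup>b/\<lambda>\<^esup>\<close> when \<open>M\<close> bounds its moment
  of order \<open>\<lambda>\<close>, and likewise for \<open>f\<close> with \<open>a\<close>; in the product the masses cancel and a multiple
  of \<open>I\<close> remains. The optimal constant is the supremum of the admissible constants.
\<close>

section \<open>Sigma-finiteness and the Carlson-type inequality\<close>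

text \<open>Completion keeps the old measurable sets and their measures, so the same countable cover
  works. Since \<open>lebesgue\<close> is the completion of \<open>lborel\<close>, this opens the
  way to Tonelli's theorem below.\<close>

lemma sigma_finite_measure_completion:
  assumes "sigma_finite_measure M"
  shows "sigma_finite_measure (completion M)"
proof -
  obtain A where "countable A" "A \<subseteq> sets M" "\<Union>A = space M" "\<forall>a\<in>A. emeasure M a \<noteq> \<infinity>"
    using sigma_finite_measure.sigma_finite_countable[OF assms] by blast
  then show ?thesis
    by (intro sigma_finite_measure.intro exI[of _ A]) (auto intro: sets_completionI_sets emeasure_completion)
qed

lemma sigma_finite_lebesgue_on:
  assumes "S \<in> sets lebesgue"
  shows "sigma_finite_measure (lebesgue_on S :: 'a::euclidean_space measure)"
  by (intro sigma_finite_measure_restrict_space sigma_finite_measure_completion assms)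
     (rule sigma_finite_lborel)

text \<open>Dyadic decomposition around \<open>x0\<close> at scale \<open>R\<close>; this keeps track of the
  factor \<open>R ^ DIM('a)\<close> without a change of variables.\<close>

lemma nn_integral_max_powr_le:
  assumes q: "q > real DIM('a::euclidean_space)"
  shows "\<exists>K>0. \<forall>R>0. \<forall>x0::'a.
    (\<integral>\<^sup>+y. ennreal (max 1 (norm (y - x0) / R) powr - q) \<partial>lebesgue) \<le> ennreal (K * R ^ DIM('a))"
proof (intro exI conjI allI impI)
  let ?d = "DIM('a)"
  \<comment> \<open>Ratio of the dyadic series: the weight drops by \<open>2 powr - q\<close> from
    one scale to the next while the volume grows by \<open>2 ^ d\<close>. The assumption on
    \<open>q\<close> says that \<open>z < 1\<close>.\<close>
  define z where "z = 2 powr (real ?d - q)"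
  have z: "0 < z" "z < 1"
    using q by (auto simp: z_def powr_less_one)
  define K where "K = unit_ball_vol (real ?d) * 2 ^ ?d * (1 / (1 - z))"
  show "K > 0" using z by (simp add: K_def unit_ball_vol_pos)
  fix R :: real and x0 :: 'a
  assume R: "R > 0"
  \<comment> \<open>Full balls replace annuli: their overlap only enlarges an upper bound, and their
    volumes are explicit.\<close>
  define T where "T k y = ennreal (2 powr (- q * real k)) * indicator (cball x0 (R * 2 ^ Suc k)) y" for k y
  have pw: "ennreal (max 1 (norm (y - x0) / R) powr - q) \<le> (\<Sum>k. T k y)" for y
  proof -
    define u where "u = norm (y - x0) / R"
    have ex: "\<exists>k. u \<le> 2 ^ Suc k"
      proof -
      obtain k where "u < 2 ^ k" using real_arch_pow[of 2 u] by auto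
      also have "(2::real) ^ k \<le> 2 ^ Suc k" by simp
      finally show ?thesis by (auto intro: less_imp_le)
    qed
    \<comment> \<open>Minimality bounds the distance from below: failure at the preceding index
      gives \<open>2 ^ k < u\<close>, and for \<open>k = 0\<close> the truncation at 1 takes
      over.\<close>
    define k where "k = (LEAST k. u \<le> 2 ^ Suc k)"
    have k: "u \<le> 2 ^ Suc k" unfolding k_def using ex by (rule LeastI_ex)
    have "2 ^ k \<le> max 1 u"
    proof (cases k)
      case (Suc j)
      then have "\<not> u \<le> 2 ^ Suc j" unfolding k_def using not_less_Least lessI by metis
      then show ?thesis using Suc by simp
    qed simp
    then have "max 1 u powr - q \<le> (2 ^ k) powr - q"
      using q by (intro powr_mono2') auto
    also have "(2 ^ k) powr - q = (2::real) powr (- q * real k)"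
      by (simp add: powr_powr mult.commute flip: powr_realpow)
    finally have "ennreal (max 1 u powr - q) \<le> T k y"
      using k R by (simp add: T_def u_def dist_norm norm_minus_commute field_simps ennreal_leI)
    also have "\<dots> \<le> (\<Sum>k. T k y)"
      using sum_le_suminf[of "\<lambda>k. T k y" "{k}"] by simp
    finally show ?thesis unfolding u_def .
  qed
  have T_meas: "T k \<in> borel_measurable lebesgue" for k
    unfolding T_def by (intro borel_measurable_times_ennreal borel_measurable_const borel_measurable_indicator) simp
  have T: "(\<integral>\<^sup>+y. T k y \<partial>lebesgue) = ennreal (unit_ball_vol (real ?d) * 2 ^ ?d * R ^ ?d * z ^ k)" for k
  proof -
    have "(\<integral>\<^sup>+y. T k y \<partial>lebesgue)
        = ennreal (2 powr (- q * real k)) * emeasure lborel (cball x0 (R * 2 ^ Suc k))"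
      unfolding T_def nn_integral_completion by (subst nn_integral_cmult_indicator) auto
    also have "\<dots> = ennreal (2 powr (- q * real k) * (unit_ball_vol (real ?d) * (R * 2 ^ Suc k) ^ ?d))"
      using R by (simp add: emeasure_cball ennreal_mult)
    also have "2 powr (- q * real k) * (unit_ball_vol (real ?d) * (R * 2 ^ Suc k) ^ ?d)
        = unit_ball_vol (real ?d) * 2 ^ ?d * R ^ ?d * z ^ k"
    proof -
      have "z ^ k = 2 powr (- q * real k) * (2 ^ k) ^ ?d"
        unfolding z_def by (simp add: powr_add algebra_simps flip: powr_realpow powr_powr power_mult)
          (simp add: powr_powr algebra_simps flip: powr_add powr_realpow)
      then show ?thesis by (simp add: power_mult_distrib)
    qed
    finally show ?thesis .
  qed
  have "(\<integral>\<^sup>+y. ennreal (max 1 (norm (y - x0) / R) powr - q) \<partial>lebesgue) \<le> (\<integral>\<^sup>+y. (\<Sum>k. T k y) \<partial>lebesgue)"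
    by (intro nn_integral_mono pw)
  also have "\<dots> = (\<Sum>k. \<integral>\<^sup>+y. T k y \<partial>lebesgue)"
    by (intro nn_integral_suminf T_meas)
  also have "\<dots> = (\<Sum>k. ennreal (unit_ball_vol (real ?d) * 2 ^ ?d * R ^ ?d * z ^ k))"
    by (simp add: T)
  also have "\<dots> = ennreal (K * R ^ ?d)"
  proof (rule suminf_ennreal_eq)
    show "0 \<le> unit_ball_vol (real ?d) * 2 ^ ?d * R ^ ?d * z ^ k" for k
      using z R by (simp add: unit_ball_vol_nonneg)
    show "(\<lambda>k. unit_ball_vol (real ?d) * 2 ^ ?d * R ^ ?d * z ^ k) sums (K * R ^ ?d)"
      using sums_mult[OF geometric_sums[of z], of "unit_ball_vol (real ?d) * 2 ^ ?d * R ^ ?d"] z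
      by (simp add: K_def mult_ac)
  qed
  finally show "(\<integral>\<^sup>+y. ennreal (max 1 (norm (y - x0) / R) powr - q) \<partial>lebesgue) \<le> ennreal (K * R ^ ?d)" .
qed

text \<open>The second term covers values up to the threshold \<open>X\<close>; above it the first
  does, because \<open>r - 1\<close> is negative. The threshold is free and will later depend on the
  point.\<close>

lemma powr_le_mult_powr_plus_powr:
  fixes g X r :: real
  assumes "g \<ge> 0" "X > 0" "0 < r" "r < 1"
  shows "g powr r \<le> g * X powr (r - 1) + X powr r"
proof (cases "g \<le> X")
  case True
  then have "g powr r \<le> X powr r" using assms by (intro powr_mono2) auto
  then show ?thesis using assms by (simp add: add_increasing)
next
  case False
  then have "g powr r = g * g powr (r - 1)" using assms by (simp add: powr_diff)
  also have "\<dots> \<le> g * X powr (r - 1)"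
    using False assms by (intro mult_left_mono powr_mono2') auto
  finally show ?thesis by (simp add: add_increasing2)
qed

text \<open>The function is compared pointwise with a profile decaying like a power of the distance
  to \<open>x0\<close>. Above the profile, \<open>g powr r\<close> is paid for by mass and moment;
  below it, by the integral of the profile's \<open>r\<close>-th power, which converges by the
  assumption on \<open>lam\<close>. The set \<open>S\<close> is arbitrary so that boundary and
  half-space are treated at once, and \<open>K\<close> is uniform in all the data.\<close>

lemma Carlson_inequality:
  fixes lam r :: real
  assumes r: "0 < r" "r < 1" and lam: "real DIM('a::euclidean_space) * (1 / r - 1) < lam"
  shows "\<exists>K>0. \<forall>S\<in>sets lebesgue. \<forall>g::'a \<Rightarrow> real. \<forall>x0. \<forall>G>0. \<forall>M>0.
    g \<in> borel_measurable (lebesgue_on S) \<longrightarrow> (\<forall>x\<in>S. g x \<ge> 0) \<longrightarrow>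
    (\<integral>\<^sup>+y. ennreal (g y) \<partial>lebesgue_on S) \<le> ennreal G \<longrightarrow>
    (\<integral>\<^sup>+y. ennreal (norm (y - x0) powr lam * g y) \<partial>lebesgue_on S) \<le> ennreal M \<longrightarrow>
    (\<integral>\<^sup>+y. ennreal (g y powr r) \<partial>lebesgue_on S)
       \<le> ennreal (K * G powr r * (M / G) powr (real DIM('a) * (1 - r) / lam))"
proof -
  let ?d = "DIM('a)"
  have lam0: "lam > 0"
    by (rule le_less_trans[OF _ lam]) (use r in auto)
  \<comment> \<open>Decay exponent of the \<open>r\<close>-th power of the profile; the assumption
    on \<open>lam\<close> is equivalent to \<open>q\<close> exceeding the dimension.\<close>
  define q where "q = lam * r / (1 - r)"
  have "real ?d < q"
    using lam r by (simp add: q_def field_simps)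
  from nn_integral_max_powr_le[OF this] obtain K where K: "K > 0"
    and KI: "\<And>R x0. R > 0 \<Longrightarrow> (\<integral>\<^sup>+y. ennreal (max 1 (norm (y - x0 :: 'a) / R) powr - q) \<partial>lebesgue)
      \<le> ennreal (K * R ^ ?d)"
    by blast
  show ?thesis
  proof (intro exI[of _ "2 + K"] conjI ballI allI impI)
    show "2 + K > 0" using K by simp
    fix S :: "'a set" and g x0 and G M :: real
    assume S: "S \<in> sets lebesgue" and G: "G > 0" and M: "M > 0"
      and gm[measurable]: "g \<in> borel_measurable (lebesgue_on S)" and g0: "\<forall>x\<in>S. g x \<ge> 0"
      and gG: "(\<integral>\<^sup>+y. ennreal (g y) \<partial>lebesgue_on S) \<le> ennreal G"
      and gM: "(\<integral>\<^sup>+y. ennreal (norm (y - x0) powr lam * g y) \<partial>lebesgue_on S) \<le> ennreal M"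
    \<comment> \<open>The scale at which \<open>G * R powr lam = M\<close>: the mass and the
      rescaled moment then each contribute at most \<open>G\<close>. The height \<open>c\<close>
      spreads the mass \<open>G\<close> over a volume \<open>R ^ d\<close>.\<close>
    define R where "R = (M / G) powr (1 / lam)"
    have R: "R > 0" using G M by (simp add: R_def)
    have Rlam: "R powr lam = M / G" using G M lam0 by (simp add: R_def powr_powr)
    define c where "c = G / R ^ ?d"
    have c: "c > 0" using G R by (simp add: c_def)
    define u where "u y = max 1 (norm (y - x0) / R)" for y
    have u1: "u y \<ge> 1" for y by (simp add: u_def)
    have ulam: "u y powr lam \<le> 1 + norm (y - x0) powr lam * (G / M)" for y
    proof -
      have "(norm (y - x0) / R) powr lam = norm (y - x0) powr lam * (G / M)"
        using R G M by (simp add: powr_divide Rlam)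
      then show ?thesis using G M by (auto simp: u_def max_def)
    qed
    have [measurable]: "(\<lambda>y. norm (y - x0)) \<in> borel_measurable (lebesgue_on S)"
      by (intro measurable_restrict_space1 measurable_completion) measurable
    have [measurable]: "u \<in> borel_measurable (lebesgue_on S)"
      unfolding u_def by measurable
    have pw: "g y powr r \<le> c powr (r - 1) * (g y + G / M * (norm (y - x0) powr lam * g y))
        + c powr r * u y powr - q" if "y \<in> S" for y
    proof -
      \<comment> \<open>The exponent is chosen so that \<open>X powr (r - 1)\<close> grows exactly
        like \<open>u powr lam\<close>, the weight controlled by the moment.\<close>
      define X where "X = c * u y powr (- lam / (1 - r))"
      have X: "X > 0" using c u1[of y] by (simp add: X_def)
      have "(- lam / (1 - r)) * (r - 1) = lam" using r by (simp add: field_simps)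
      then have X1: "X powr (r - 1) = c powr (r - 1) * u y powr lam"
        using c by (simp add: X_def powr_mult powr_powr)
      have X2: "X powr r = c powr r * u y powr - q"
        using c by (simp add: X_def powr_mult powr_powr q_def)
      have "g y powr r \<le> g y * (c powr (r - 1) * u y powr lam) + c powr r * u y powr - q"
        using powr_le_mult_powr_plus_powr[of "g y" X r] X r g0 that by (simp add: X1 X2)
      also have "g y * (c powr (r - 1) * u y powr lam)
          \<le> g y * (c powr (r - 1) * (1 + norm (y - x0) powr lam * (G / M)))"
        using g0 that by (intro mult_left_mono ulam) auto
      finally show ?thesis by (simp add: algebra_simps)
    qed
    have "(\<integral>\<^sup>+y. ennreal (u y powr - q) \<partial>lebesgue_on S) \<le> (\<integral>\<^sup>+y. ennreal (u y powr - q) \<partial>lebesgue)"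
      using S by (subst nn_integral_restrict_space) (auto intro!: nn_integral_mono split: split_indicator)
    also have "\<dots> \<le> ennreal (K * R ^ ?d)"
      unfolding u_def by (rule KI[OF R])
    finally have uI: "(\<integral>\<^sup>+y. ennreal (u y powr - q) \<partial>lebesgue_on S) \<le> ennreal (K * R ^ ?d)" .
    have "(\<integral>\<^sup>+y. ennreal (g y powr r) \<partial>lebesgue_on S)
      \<le> (\<integral>\<^sup>+y. ennreal (c powr (r - 1)) * (ennreal (g y) + ennreal (G / M) * ennreal (norm (y - x0) powr lam * g y))
          + ennreal (c powr r) * ennreal (u y powr - q) \<partial>lebesgue_on S)"
    proof (rule nn_integral_mono)
      fix y assume "y \<in> space (lebesgue_on S)"
      then have y: "y \<in> S" by (simp add: space_restrict_space)
      have "ennreal (g y powr r) \<le> ennreal (c powr (r - 1) * (g y + G / M * (norm (y - x0) powr lam * g y))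
        + c powr r * u y powr - q)"
        by (rule ennreal_leI[OF pw[OF y]])
      also have "\<dots> = ennreal (c powr (r - 1)) * (ennreal (g y) + ennreal (G / M) * ennreal (norm (y - x0) powr lam * g y))
          + ennreal (c powr r) * ennreal (u y powr - q)"
      proof -
        have "0 \<le> norm (y - x0) powr lam * g y" using g0 y by simp
        then show ?thesis
          using g0 y G M by (simp only: ennreal_mult ennreal_plus divide_nonneg_pos less_imp_le
            powr_ge_zero mult_nonneg_nonneg add_nonneg_nonneg)
      qed
      finally show "ennreal (g y powr r) \<le> \<dots>" .
    qed
    also have "\<dots> = ennreal (c powr (r - 1)) * ((\<integral>\<^sup>+y. ennreal (g y) \<partial>lebesgue_on S)
        + ennreal (G / M) * (\<integral>\<^sup>+y. ennreal (norm (y - x0) powr lam * g y) \<partial>lebesgue_on S))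
        + ennreal (c powr r) * (\<integral>\<^sup>+y. ennreal (u y powr - q) \<partial>lebesgue_on S)"
      by (simp add: nn_integral_add nn_integral_cmult)
    also have "\<dots> \<le> ennreal (c powr (r - 1)) * (ennreal G + ennreal (G / M) * ennreal M)
        + ennreal (c powr r) * ennreal (K * R ^ ?d)"
      by (intro add_mono mult_left_mono gG gM uI) auto
    also have "\<dots>
        = ennreal (c powr (r - 1) * (2 * G) + c powr r * (K * R ^ ?d))"
      using G M K R by (simp add: flip: ennreal_mult ennreal_plus)
    \<comment> \<open>Since \<open>c * R ^ d = G\<close>, the two parts of the estimate have the
      same size up to constants.\<close>
    also have "c powr (r - 1) * (2 * G) + c powr r * (K * R ^ ?d) = (2 + K) * (c powr r * R ^ ?d)"
    proof -
      have "c powr (r - 1) * G = c powr r * R ^ ?d"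
        using c G R by (simp add: powr_diff) (simp add: c_def field_simps)
      then show ?thesis by (simp add: algebra_simps)
    qed
    also have "c powr r * R ^ ?d = G powr r * (M / G) powr (real ?d * (1 - r) / lam)"
    proof -
      have "c powr r * R ^ ?d = G powr r * (R powr real ?d) powr (1 - r)"
        using R G by (simp add: c_def powr_divide powr_diff powr_realpow)
      also have "(R powr real ?d) powr (1 - r) = (M / G) powr (real ?d * (1 - r) / lam)"
        by (simp add: R_def powr_powr)
      finally show ?thesis .
    qed
    finally show "(\<integral>\<^sup>+y. ennreal (g y powr r) \<partial>lebesgue_on S)
       \<le> ennreal ((2 + K) * G powr r * (M / G) powr (real ?d * (1 - r) / lam))"
      by (simp only: mult.assoc)
  qed
qed

section \<open>Averaging, the half-space and the quasi-norms\<close>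

text \<open>If \<open>h\<close> exceeded the bound everywhere, the weighted integral would be at
  least \<open>2 * J\<close>. The factor 2 makes the contradiction strict without discussing
  equality almost everywhere.\<close>

lemma exists_le_of_weighted_nn_integral_le:
  fixes f h :: "'a \<Rightarrow> ennreal" and J F :: real
  assumes [measurable]: "f \<in> borel_measurable M"
    and F: "F > 0" "(\<integral>\<^sup>+x. f x \<partial>M) = ennreal F"
    and J: "J > 0" "(\<integral>\<^sup>+x. f x * h x \<partial>M) \<le> ennreal J"
  shows "\<exists>x\<in>space M. h x \<le> ennreal (2 * J / F)"
proof (rule ccontr)
  assume "\<not> ?thesis"
  then have "\<And>x. x \<in> space M \<Longrightarrow> ennreal (2 * J / F) \<le> h x"
    by (meson linear)
  then have "(\<integral>\<^sup>+x. f x * ennreal (2 * J / F) \<partial>M) \<le> (\<integral>\<^sup>+x. f x * h x \<partial>M)"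
    by (intro nn_integral_mono mult_left_mono) auto
  also have "(\<integral>\<^sup>+x. f x * ennreal (2 * J / F) \<partial>M) = ennreal (2 * J)"
    using F J by (simp add: nn_integral_multc flip: ennreal_mult)
  also note J(2)
  finally show False using J by simp
qed

lemma half_space_lebesgue: "(half_space :: ((real^'m::finite) \<times> real) set) \<in> sets lebesgue"
proof -
  have "open (half_space :: ((real^'m) \<times> real) set)"
    unfolding half_space_def by (intro open_Collect_less continuous_intros)
  then show ?thesis by simp
qed

lemma space_lebesgue_on_half_space: "space (lebesgue_on half_space) = half_space"
  by (simp add: space_restrict_space)

text \<open>Passes from the extended nonnegative integral, which the Carlson-type inequality bounds,
  to the Bochner integral inside \<open>Lqnorm\<close>.\<close>

lemma Lqnorm_le:
  assumes "f \<in> borel_measurable M" "\<theta> > 0" "T \<ge> 0"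
    and "(\<integral>\<^sup>+x. ennreal (\<bar>f x\<bar> powr \<theta>) \<partial>M) \<le> ennreal T"
  shows "Lqnorm M \<theta> f \<le> T powr (1 / \<theta>)"
proof -
  have "(\<integral>x. \<bar>f x\<bar> powr \<theta> \<partial>M) = enn2real (\<integral>\<^sup>+x. ennreal (\<bar>f x\<bar> powr \<theta>) \<partial>M)"
    using assms(1) by (intro integral_eq_nn_integral) auto
  also have "\<dots> \<le> T" using assms by (intro enn2real_leI)
  finally show ?thesis unfolding Lqnorm_def
    using assms by (intro powr_mono2) auto
qed

text \<open>Mostly used in contrapositive form: a nonzero quasi-norm excludes functions vanishing
  almost everywhere.\<close>

lemma Lqnorm_eq_0:
  assumes "AE x in M. f x = 0"
  shows "Lqnorm M \<theta> f = 0"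
proof -
  have "(\<integral>x. \<bar>f x\<bar> powr \<theta> \<partial>M) = 0"
    by (rule integral_eq_zero_AE) (use assms in eventually_elim, simp)
  then show ?thesis by (simp add: Lqnorm_def)
qed

lemma Lqnorm_nonneg: "Lqnorm M \<theta> f \<ge> 0"
  by (simp add: Lqnorm_def)

section \<open>Potentials, and finiteness of the masses when the form is finite\<close>

definition boundary_potential :: "real \<Rightarrow> (real^'m::finite \<Rightarrow> real) \<Rightarrow> (real^'m) \<times> real \<Rightarrow> ennreal" where
  "boundary_potential lam f y = (\<integral>\<^sup>+x. ennreal (norm ((x, 0) - y) powr lam * f x) \<partial>lebesgue)"

definition interior_potential :: "real \<Rightarrow> ((real^'m::finite) \<times> real \<Rightarrow> real) \<Rightarrow> real^'m \<Rightarrow> ennreal" where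
  "interior_potential lam g x =
     (\<integral>\<^sup>+y. ennreal (norm ((x, 0) - y) powr lam * g y) \<partial>(lebesgue_on half_space))"

text \<open>The product here is one of completed measures. Both coordinates are therefore first read
  as maps into Borel spaces, where the kernel is continuous up to a power.\<close>

lemma borel_measurable_kernel:
  "(\<lambda>z. norm ((fst z, 0) - snd z) powr lam)
     \<in> borel_measurable ((lebesgue :: (real^'m::finite) measure) \<Otimes>\<^sub>M (lebesgue_on half_space))"
proof -
  have [measurable]: "(\<lambda>x. x) \<in> measurable (lebesgue :: (real^'m) measure) borel"
    "(\<lambda>x. x) \<in> measurable (lebesgue_on half_space :: ((real^'m) \<times> real) measure) borel"
    by (intro measurable_restrict_space1 measurable_completion; simp)+
  have [measurable]: "fst \<in> measurable ((lebesgue :: (real^'m) measure) \<Otimes>\<^sub>M (lebesgue_on half_space :: ((real^'m) \<times> real) measure)) borel"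
    by (rule measurable_compose[OF measurable_fst]) measurable
  have [measurable]: "snd \<in> measurable ((lebesgue :: (real^'m) measure) \<Otimes>\<^sub>M (lebesgue_on half_space :: ((real^'m) \<times> real) measure)) borel"
    by (rule measurable_compose[OF measurable_snd]) measurable
  show ?thesis by measurable
qed

context
  fixes lam :: real and f :: "real^'m::finite \<Rightarrow> real" and g :: "(real^'m) \<times> real \<Rightarrow> real"
  assumes f: "f \<in> borel_measurable lebesgue" "\<And>x. f x \<ge> 0"
    and g: "g \<in> borel_measurable (lebesgue_on half_space)" "\<And>y. y \<in> half_space \<Longrightarrow> g y \<ge> 0"
begin

lemma HLS_form_eq_boundary_potential:
  "HLS_form lam f g = (\<integral>\<^sup>+y. ennreal (g y) * boundary_potential lam f y \<partial>(lebesgue_on half_space))"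
  unfolding HLS_form_def
proof (rule nn_integral_cong)
  fix y assume "y \<in> space (lebesgue_on half_space :: ((real^'m) \<times> real) measure)"
  then have y: "g y \<ge> 0" using g by (simp add: space_lebesgue_on_half_space)
  have [measurable]: "(\<lambda>x. norm ((x, 0) - y) powr lam * f x) \<in> borel_measurable lebesgue"
    by (intro borel_measurable_times f measurable_completion) measurable
  have "(\<integral>\<^sup>+x. ennreal (f x * norm ((x, 0) - y) powr lam * g y) \<partial>lebesgue)
      = (\<integral>\<^sup>+x. ennreal (g y) * ennreal (norm ((x, 0) - y) powr lam * f x) \<partial>lebesgue)"
    using y f by (intro nn_integral_cong) (simp add: mult_ac flip: ennreal_mult)
  then show "(\<integral>\<^sup>+x. ennreal (f x * norm ((x, 0) - y) powr lam * g y) \<partial>lebesgue)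
      = ennreal (g y) * boundary_potential lam f y"
    by (simp add: boundary_potential_def nn_integral_cmult)
qed

text \<open>Tonelli's theorem for two sigma-finite measures. With both orders of integration
  available, averaging can be done against \<open>f\<close> as well as against
  \<open>g\<close>.\<close>

lemma HLS_form_eq_interior_potential:
  "HLS_form lam f g = (\<integral>\<^sup>+x. ennreal (f x) * interior_potential lam g x \<partial>lebesgue)"
proof -
  interpret pair_sigma_finite "lebesgue :: (real^'m) measure" "lebesgue_on half_space :: ((real^'m) \<times> real) measure"
    by (intro pair_sigma_finite.intro sigma_finite_lebesgue_on half_space_lebesgue
        sigma_finite_measure_completion sigma_finite_lborel)
  note [measurable] = f(1) g(1) borel_measurable_kernel
  have "HLS_form lam f g = (\<integral>\<^sup>+x. (\<integral>\<^sup>+y. ennreal (f x * norm ((x, 0) - y) powr lam * g y)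
      \<partial>(lebesgue_on half_space)) \<partial>lebesgue)"
    unfolding HLS_form_def
  proof (rule Fubini')
    have "(\<lambda>z. ennreal (f (fst z) * norm ((fst z, 0) - snd z) powr lam * g (snd z)))
        \<in> borel_measurable ((lebesgue :: (real^'m) measure) \<Otimes>\<^sub>M (lebesgue_on half_space))"
      by measurable
    then show "(\<lambda>(x, y). ennreal (f x * norm ((x, 0) - y) powr lam * g y))
        \<in> borel_measurable ((lebesgue :: (real^'m) measure) \<Otimes>\<^sub>M (lebesgue_on half_space))"
      by (simp add: case_prod_beta')
  qed
  also have "\<dots> = (\<integral>\<^sup>+x. ennreal (f x) * interior_potential lam g x \<partial>lebesgue)"
  proof (rule nn_integral_cong)
    fix x :: "real^'m"
    have [measurable]: "(\<lambda>y. norm ((x, 0) - y) powr lam * g y) \<in> borel_measurable (lebesgue_on half_space)"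
      by (intro borel_measurable_times g measurable_restrict_space1 measurable_completion) measurable
    have "(\<integral>\<^sup>+y. ennreal (f x * norm ((x, 0) - y) powr lam * g y) \<partial>(lebesgue_on half_space))
        = (\<integral>\<^sup>+y. ennreal (f x) * ennreal (norm ((x, 0) - y) powr lam * g y) \<partial>(lebesgue_on half_space))"
      using f g by (intro nn_integral_cong) (simp add: space_lebesgue_on_half_space mult_ac flip: ennreal_mult)
    then show "(\<integral>\<^sup>+y. ennreal (f x * norm ((x, 0) - y) powr lam * g y) \<partial>(lebesgue_on half_space))
        = ennreal (f x) * interior_potential lam g x"
      by (simp add: interior_potential_def nn_integral_cmult)
  qed
  finally show ?thesis .
qed

lemma borel_measurable_interior_potential [measurable]:
  "interior_potential lam g \<in> borel_measurable lebesgue"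
proof -
  interpret sigma_finite_measure "lebesgue_on half_space :: ((real^'m) \<times> real) measure"
    by (intro sigma_finite_lebesgue_on half_space_lebesgue)
  note [measurable] = g(1) borel_measurable_kernel
  have "(\<lambda>z. ennreal (norm ((fst z, 0) - snd z) powr lam * g (snd z)))
        \<in> borel_measurable ((lebesgue :: (real^'m) measure) \<Otimes>\<^sub>M (lebesgue_on half_space))"
    by measurable
  then show ?thesis
    unfolding interior_potential_def[abs_def]
    by (intro borel_measurable_nn_integral) (simp add: case_prod_beta')
qed

lemma borel_measurable_boundary_potential [measurable]:
  "boundary_potential lam f \<in> borel_measurable (lebesgue_on half_space)"
proof -
  interpret P: pair_sigma_finite "lebesgue :: (real^'m) measure" "lebesgue_on half_space :: ((real^'m) \<times> real) measure"
    by (intro pair_sigma_finite.intro sigma_finite_lebesgue_on half_space_lebesgue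
        sigma_finite_measure_completion sigma_finite_lborel)
  note [measurable] = f(1) borel_measurable_kernel
  have "(\<lambda>z. ennreal (norm ((fst z, 0) - snd z) powr lam * f (fst z)))
        \<in> borel_measurable ((lebesgue :: (real^'m) measure) \<Otimes>\<^sub>M (lebesgue_on half_space))"
    by measurable
  \<comment> \<open>The variable integrated out is the first coordinate here, hence the
    swap.\<close>
  from measurable_compose[OF measurable_pair_swap' this] show ?thesis
    unfolding boundary_potential_def[abs_def]
    by (intro P.M1.borel_measurable_nn_integral) (simp add: case_prod_beta')
qed

text \<open>At an interior point the kernel is at least \<open>snd y powr lam > 0\<close>, so a
  non-integrable \<open>f\<close> has infinite potential throughout the half-space. Finiteness of
  the form then forces \<open>g\<close> to vanish almost everywhere.\<close>

lemma nn_integral_boundary_finite: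
  assumes "HLS_form lam f g < \<infinity>" "Lqnorm (lebesgue_on half_space) r g \<noteq> 0"
    and lam: "lam > 0"
  shows "(\<integral>\<^sup>+x. ennreal (f x) \<partial>lebesgue) < \<infinity>"
proof (rule ccontr)
  assume "\<not> ?thesis"
  then have inf: "(\<integral>\<^sup>+x. ennreal (f x) \<partial>lebesgue) = \<infinity>"
    by (simp add: not_less top_unique)
  note [measurable] = f(1) g(1)
  have top: "boundary_potential lam f y = \<infinity>" if "y \<in> half_space" for y
  proof -
    have sy: "snd y > 0" using that by (simp add: half_space_def)
    have "(\<integral>\<^sup>+x. ennreal (snd y powr lam) * ennreal (f x) \<partial>lebesgue) \<le> boundary_potential lam f y"
      unfolding boundary_potential_def
    proof (rule nn_integral_mono)
      fix x
      have "snd y \<le> norm ((x, 0) - y)"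
        using norm_snd_le[of "snd ((x, 0) - y)" "fst ((x, 0) - y)"] sy unfolding prod.collapse by simp
      then have "snd y powr lam \<le> norm ((x, 0) - y) powr lam"
        using sy lam by (intro powr_mono2) auto
      then show "ennreal (snd y powr lam) * ennreal (f x) \<le> ennreal (norm ((x, 0) - y) powr lam * f x)"
        using f(2)[of x] by (simp add: ennreal_leI mult_right_mono flip: ennreal_mult)
    qed
    then show ?thesis using sy inf by (simp add: nn_integral_cmult ennreal_mult_top top_unique)
  qed
  have "AE y in lebesgue_on half_space. ennreal (g y) * boundary_potential lam f y \<noteq> \<infinity>"
    using assms(1) by (intro nn_integral_PInf_AE) (auto simp: HLS_form_eq_boundary_potential)
  moreover have "AE y in lebesgue_on half_space. y \<in> half_space"
    by (rule AE_I2) (simp add: space_lebesgue_on_half_space)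
  ultimately have "AE y in lebesgue_on half_space. g y = 0"
  proof eventually_elim
    case (elim y)
    then have "ennreal (g y) = 0" using top by (auto simp: ennreal_mult_eq_top_iff)
    then show ?case using g elim by (simp add: ennreal_eq_0_iff antisym)
  qed
  then show False using assms(2) Lqnorm_eq_0 by blast
qed

text \<open>If the form is finite, the potential of \<open>g\<close> is finite at two distinct points, and
  \<open>|a - b|\<^sup>\<lambda>\<close> is dominated by \<open>|a - y|\<^sup>\<lambda> + |b - y|\<^sup>\<lambda>\<close>.\<close>

lemma nn_integral_interior_finite:
  assumes "HLS_form lam f g < \<infinity>" "Lqnorm lebesgue p f \<noteq> 0"
    and lam: "lam > 0"
  shows "(\<integral>\<^sup>+y. ennreal (g y) \<partial>lebesgue_on half_space) < \<infinity>"
proof -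
  note [measurable] = f(1) g(1)
  have fin: "AE x in lebesgue. ennreal (f x) * interior_potential lam g x \<noteq> \<infinity>"
    using assms(1) by (intro nn_integral_PInf_AE) (auto simp: HLS_form_eq_interior_potential)
  \<comment> \<open>Otherwise the potential is infinite off one point, a null set, and
    \<open>f\<close> vanishes almost everywhere. Excluding an arbitrary \<open>c\<close> allows a
    second point to be picked after the first.\<close>
  have "\<exists>a. a \<noteq> c \<and> interior_potential lam g a \<noteq> \<infinity>" for c
  proof (rule ccontr)
    assume top: "\<not> ?thesis"
    have "AE x in lebesgue. x \<noteq> c"
      by (rule AE_I'[of "{c}"]) auto
    with fin have "AE x in lebesgue. f x = 0"
    proof eventually_elim
      case (elim x)
      then have "ennreal (f x) = 0" using top by (auto simp: ennreal_mult_eq_top_iff)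
      then show ?case using f(2)[of x] by (simp add: ennreal_eq_0_iff antisym)
    qed
    then show False using assms(2) Lqnorm_eq_0 by blast
  qed
  then obtain a b where ab: "a \<noteq> b" "interior_potential lam g a \<noteq> \<infinity>" "interior_potential lam g b \<noteq> \<infinity>"
    by metis
  \<comment> \<open>By the triangle inequality one of the two distances to \<open>y\<close> is at
    least half of \<open>norm (a - b)\<close>. One point would not do: the kernel has no positive
    lower bound near it.\<close>
  define D where "D = (norm (a - b) / 2) powr lam"
  have D: "D > 0" using ab by (simp add: D_def)
  have k: "D \<le> norm ((a, 0) - y) powr lam + norm ((b, 0) - y) powr lam" for y :: "(real^'m) \<times> real"
  proof -
    have "norm (a - b) \<le> norm ((a, 0) - y) + norm ((b, 0) - y)"
      using norm_triangle_ineq4[of "(a, 0) - y" "(b, 0) - y"] by simp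
    then have "norm (a - b) / 2 \<le> norm ((a, 0) - y) \<or> norm (a - b) / 2 \<le> norm ((b, 0) - y)"
      by linarith
    then have "D \<le> norm ((a, 0) - y) powr lam \<or> D \<le> norm ((b, 0) - y) powr lam"
      unfolding D_def using lam by (auto intro: powr_mono2)
    then show ?thesis by (smt (verit) powr_ge_zero)
  qed
  have [measurable]: "(\<lambda>y. norm ((x, 0) - y) powr lam) \<in> borel_measurable (lebesgue_on half_space)" for x :: "real^'m"
    by (intro measurable_restrict_space1 measurable_completion) measurable
  have "ennreal D * (\<integral>\<^sup>+y. ennreal (g y) \<partial>lebesgue_on half_space)
      = (\<integral>\<^sup>+y. ennreal D * ennreal (g y) \<partial>lebesgue_on half_space)"
    by (simp add: nn_integral_cmult)
  also have "\<dots> \<le> (\<integral>\<^sup>+y. ennreal (norm ((a, 0) - y) powr lam * g y) + ennreal (norm ((b, 0) - y) powr lam * g y) \<partial>lebesgue_on half_space)"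
  proof (rule nn_integral_mono)
    fix y assume "y \<in> space (lebesgue_on half_space :: ((real^'m) \<times> real) measure)"
    then have y: "g y \<ge> 0" using g by (simp add: space_lebesgue_on_half_space)
    have "D * g y \<le> norm ((a, 0) - y) powr lam * g y + norm ((b, 0) - y) powr lam * g y"
      using mult_right_mono[OF k y] by (simp add: algebra_simps)
    then show "ennreal D * ennreal (g y) \<le> ennreal (norm ((a, 0) - y) powr lam * g y) + ennreal (norm ((b, 0) - y) powr lam * g y)"
      using y D by (simp add: ennreal_leI flip: ennreal_mult ennreal_plus)
  qed
  also have "\<dots> = interior_potential lam g a + interior_potential lam g b"
    unfolding interior_potential_def by (simp add: nn_integral_add)
  also have "\<dots> < \<infinity>" using ab by (simp add: less_top)
  finally show ?thesis using D by (auto simp: ennreal_mult_less_top)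
qed

end

section \<open>Existence of a positive admissible constant\<close>

text \<open>The scaling condition enters twice. Both summands are positive, so each is below
  \<open>lam\<close> and the Carlson-type inequality applies on both sides; and their shares of
  \<open>lam\<close> add up to 1, so the final bound is linear in the form.\<close>

lemma reverse_HLS_constant_exists:
  fixes lam p r :: real
  assumes p: "0 < p" "p < 1" and r: "0 < r" "r < 1"
    and lam: "real CARD('m::finite) * (1 / p - 1) + (real CARD('m) + 1) * (1 / r - 1) = lam"
  shows "\<exists>C>0. reverse_HLS_constant TYPE('m) lam p r C"
proof -
  define a where "a = real CARD('m) * (1 / p - 1)"
  define b where "b = (real CARD('m) + 1) * (1 / r - 1)"
  have a: "a > 0" using p by (simp add: a_def)
  have b: "b > 0" using r unfolding b_def by (intro mult_pos_pos) auto
  have ab: "a + b = lam" using lam by (simp add: a_def b_def)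
  have lam0: "lam > 0" using a b ab by simp
  have da: "real DIM(real^'m) * (1 / p - 1) = a" "real DIM((real^'m) \<times> real) * (1 / r - 1) = b"
    by (simp_all add: a_def b_def)
  obtain K1 where K1: "K1 > 0" and C1: "\<And>(g :: real^'m \<Rightarrow> real) x0 G M. G > 0 \<Longrightarrow> M > 0 \<Longrightarrow>
    g \<in> borel_measurable lebesgue \<Longrightarrow> (\<And>x. g x \<ge> 0) \<Longrightarrow>
    (\<integral>\<^sup>+y. ennreal (g y) \<partial>lebesgue) \<le> ennreal G \<Longrightarrow>
    (\<integral>\<^sup>+y. ennreal (norm (y - x0) powr lam * g y) \<partial>lebesgue) \<le> ennreal M \<Longrightarrow>
    (\<integral>\<^sup>+y. ennreal (g y powr p) \<partial>lebesgue)
       \<le> ennreal (K1 * G powr p * (M / G) powr (real DIM(real^'m) * (1 - p) / lam))"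
  proof -
    have "real DIM(real^'m) * (1 / p - 1) < lam" using da a b ab by simp
    from Carlson_inequality[OF p this] obtain K where "K > 0" and K: "\<forall>S\<in>sets lebesgue. \<forall>g::real^'m \<Rightarrow> real. \<forall>x0. \<forall>G>0. \<forall>M>0.
    g \<in> borel_measurable (lebesgue_on S) \<longrightarrow> (\<forall>x\<in>S. g x \<ge> 0) \<longrightarrow>
    (\<integral>\<^sup>+y. ennreal (g y) \<partial>lebesgue_on S) \<le> ennreal G \<longrightarrow>
    (\<integral>\<^sup>+y. ennreal (norm (y - x0) powr lam * g y) \<partial>lebesgue_on S) \<le> ennreal M \<longrightarrow>
    (\<integral>\<^sup>+y. ennreal (g y powr p) \<partial>lebesgue_on S)
       \<le> ennreal (K * G powr p * (M / G) powr (real DIM(real^'m) * (1 - p) / lam))"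
      by blast
    show ?thesis
      using K[rule_format, of UNIV] by (intro that[OF \<open>K > 0\<close>]) (simp add: lebesgue_on_UNIV_eq)
  qed
  obtain K2 where K2: "K2 > 0" and C2: "\<And>(g :: (real^'m) \<times> real \<Rightarrow> real) x0 G M. G > 0 \<Longrightarrow> M > 0 \<Longrightarrow>
    g \<in> borel_measurable (lebesgue_on half_space) \<Longrightarrow> (\<And>x. x \<in> half_space \<Longrightarrow> g x \<ge> 0) \<Longrightarrow>
    (\<integral>\<^sup>+y. ennreal (g y) \<partial>lebesgue_on half_space) \<le> ennreal G \<Longrightarrow>
    (\<integral>\<^sup>+y. ennreal (norm (y - x0) powr lam * g y) \<partial>lebesgue_on half_space) \<le> ennreal M \<Longrightarrow>
    (\<integral>\<^sup>+y. ennreal (g y powr r) \<partial>lebesgue_on half_space)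
       \<le> ennreal (K2 * G powr r * (M / G) powr (real DIM((real^'m) \<times> real) * (1 - r) / lam))"
  proof -
    have "real DIM((real^'m) \<times> real) * (1 / r - 1) < lam" using da a b ab by simp
    from Carlson_inequality[OF r this] obtain K where "K > 0" and K: "\<forall>S\<in>sets lebesgue. \<forall>g::(real^'m) \<times> real \<Rightarrow> real. \<forall>x0. \<forall>G>0. \<forall>M>0.
    g \<in> borel_measurable (lebesgue_on S) \<longrightarrow> (\<forall>x\<in>S. g x \<ge> 0) \<longrightarrow>
    (\<integral>\<^sup>+y. ennreal (g y) \<partial>lebesgue_on S) \<le> ennreal G \<longrightarrow>
    (\<integral>\<^sup>+y. ennreal (norm (y - x0) powr lam * g y) \<partial>lebesgue_on S) \<le> ennreal M \<longrightarrow>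
    (\<integral>\<^sup>+y. ennreal (g y powr r) \<partial>lebesgue_on S)
       \<le> ennreal (K * G powr r * (M / G) powr (real DIM((real^'m) \<times> real) * (1 - r) / lam))"
      by blast
    show ?thesis
      by (rule that[OF \<open>K > 0\<close>], rule K[rule_format, OF half_space_lebesgue])
  qed
  define A where "A = K1 powr (1 / p)"
  define B where "B = K2 powr (1 / r)"
  have AB: "A > 0" "B > 0" using K1 K2 by (simp_all add: A_def B_def)
  \<comment> \<open>\<open>J\<close> is a positive upper bound of the form, not its value, because
    averaging and the moment bounds require positive numbers.\<close>
  have main: "Lqnorm lebesgue p f * Lqnorm (lebesgue_on half_space) r g \<le> 2 * A * B * J"
    if f: "f \<in> borel_measurable lebesgue" "\<And>x. f x \<ge> 0"
      and g: "g \<in> borel_measurable (lebesgue_on half_space)" "\<And>y. y \<in> half_space \<Longrightarrow> g y \<ge> 0"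
      and J: "J > 0" "HLS_form lam f g \<le> ennreal J"
      and F: "F > 0" "(\<integral>\<^sup>+x. ennreal (f x) \<partial>lebesgue) = ennreal F"
      and G: "G > 0" "(\<integral>\<^sup>+y. ennreal (g y) \<partial>lebesgue_on half_space) = ennreal G"
    for f :: "real^'m \<Rightarrow> real" and g :: "(real^'m) \<times> real \<Rightarrow> real" and J F G :: real
  proof -
    \<comment> \<open>The quotient of moment bound and mass, which is the same for \<open>f\<close>
      and for \<open>g\<close>.\<close>
    define t where "t = 2 * J / (F * G)"
    have t: "t > 0" using J F G by (simp add: t_def)
    have "\<exists>x\<in>space lebesgue. interior_potential lam g x \<le> ennreal (2 * J / F)"
      by (rule exists_le_of_weighted_nn_integral_le[OF _ F J(1)])
         (use f J(2) in \<open>auto simp: HLS_form_eq_interior_potential[OF f g]\<close>)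
    then obtain x0 where x0: "interior_potential lam g x0 \<le> ennreal (2 * J / F)" by blast
    have "\<exists>y\<in>space (lebesgue_on half_space). boundary_potential lam f y \<le> ennreal (2 * J / G)"
      by (rule exists_le_of_weighted_nn_integral_le[OF _ G J(1)])
         (use g J(2) in \<open>auto simp: HLS_form_eq_boundary_potential[OF f g]\<close>)
    then obtain y0 where y0: "boundary_potential lam f y0 \<le> ennreal (2 * J / G)" by blast
    \<comment> \<open>The centre \<open>y0\<close> lies off the boundary; projecting it onto the
      boundary only shortens distances to boundary points.\<close>
    have "(\<integral>\<^sup>+x. ennreal (norm (x - fst y0) powr lam * f x) \<partial>lebesgue) \<le> boundary_potential lam f y0"
      unfolding boundary_potential_def
    proof (intro nn_integral_mono ennreal_leI mult_right_mono powr_mono2)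
      fix x
      show "norm (x - fst y0) \<le> norm ((x, 0) - y0)"
        using norm_fst_le[of "fst ((x, 0) - y0)" "snd ((x, 0) - y0)"] unfolding prod.collapse by simp
    qed (use lam0 f in auto)
    also note y0
    finally have "(\<integral>\<^sup>+x. ennreal (\<bar>f x\<bar> powr p) \<partial>lebesgue)
        \<le> ennreal (K1 * F powr p * (2 * J / G / F) powr (real DIM(real^'m) * (1 - p) / lam))"
      using C1[of F "2 * J / G" f "fst y0"] F G J f by simp
    then have "Lqnorm lebesgue p f
        \<le> (K1 * F powr p * (2 * J / G / F) powr (real DIM(real^'m) * (1 - p) / lam)) powr (1 / p)"
      using f p K1 by (intro Lqnorm_le) auto
    also have "\<dots> = A * F * t powr (a / lam)"
    proof -
      have "2 * J / G / F = t" by (simp add: t_def mult.commute)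
      moreover have "real DIM(real^'m) * (1 - p) / lam * (1 / p) = a / lam"
        using p by (simp add: a_def field_simps)
      ultimately show ?thesis
        using K1 F p t by (simp only: powr_mult powr_powr A_def) simp
    qed
    finally have fle: "Lqnorm lebesgue p f \<le> A * F * t powr (a / lam)" .
    have "(\<integral>\<^sup>+y. ennreal (norm (y - (x0, 0)) powr lam * g y) \<partial>lebesgue_on half_space) \<le> ennreal (2 * J / F)"
      using x0 by (simp add: interior_potential_def norm_minus_commute)
    then have "(\<integral>\<^sup>+y. ennreal (g y powr r) \<partial>lebesgue_on half_space)
        \<le> ennreal (K2 * G powr r * (2 * J / F / G) powr (real DIM((real^'m) \<times> real) * (1 - r) / lam))"
      using C2[of G "2 * J / F" g "(x0, 0)"] F G J g by simp
    also have "(\<integral>\<^sup>+y. ennreal (g y powr r) \<partial>lebesgue_on half_space)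
        = (\<integral>\<^sup>+y. ennreal (\<bar>g y\<bar> powr r) \<partial>lebesgue_on half_space)"
      using g by (intro nn_integral_cong) (simp add: space_lebesgue_on_half_space)
    finally have "Lqnorm (lebesgue_on half_space) r g
        \<le> (K2 * G powr r * (2 * J / F / G) powr (real DIM((real^'m) \<times> real) * (1 - r) / lam)) powr (1 / r)"
      using g r K2 by (intro Lqnorm_le) auto
    also have "\<dots> = B * G * t powr (b / lam)"
    proof -
      have "2 * J / F / G = t" by (simp add: t_def)
      moreover have "real DIM((real^'m) \<times> real) * (1 - r) / lam * (1 / r) = b / lam"
        using r by (simp add: b_def field_simps)
      ultimately show ?thesis
        using K2 G r t by (simp only: powr_mult powr_powr B_def) simp
    qed
    finally have gle: "Lqnorm (lebesgue_on half_space) r g \<le> B * G * t powr (b / lam)" .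
    have "Lqnorm lebesgue p f * Lqnorm (lebesgue_on half_space) r g
        \<le> (A * F * t powr (a / lam)) * (B * G * t powr (b / lam))"
      using AB F by (intro mult_mono fle gle Lqnorm_nonneg) auto
    also have "\<dots> = A * B * F * G * t powr (a / lam + b / lam)"
      by (simp add: powr_add)
    \<comment> \<open>With total exponent 1 the masses cancel, as
      \<open>F * G * t = 2 * J\<close>.\<close>
    also have "a / lam + b / lam = 1"
      using ab lam0 by (simp flip: add_divide_distrib)
    also have "A * B * F * G * t powr 1 = 2 * A * B * J"
      using F G J by (simp add: t_def)
    finally show ?thesis .
  qed
  show ?thesis
  proof (intro exI conjI)
    show "1 / (2 * A * B) > 0" using AB by simp
    show "reverse_HLS_constant TYPE('m) lam p r (1 / (2 * A * B))"
      unfolding reverse_HLS_constant_def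
    proof (intro ballI impI)
      fix f :: "real^'m \<Rightarrow> real" and g :: "(real^'m) \<times> real \<Rightarrow> real"
      assume "f \<in> Lspace lebesgue p" "g \<in> Lspace (lebesgue_on half_space) r"
        and "\<forall>x. f x \<ge> 0" "\<forall>y\<in>half_space. g y \<ge> 0"
      then have f: "f \<in> borel_measurable lebesgue" "\<And>x. f x \<ge> 0"
        and g: "g \<in> borel_measurable (lebesgue_on half_space)" "\<And>y. y \<in> half_space \<Longrightarrow> g y \<ge> 0"
        by (auto simp: Lspace_def)
      define X where "X = Lqnorm lebesgue p f * Lqnorm (lebesgue_on half_space) r g"
      have "ennreal (X / (2 * A * B)) \<le> HLS_form lam f g"
      \<comment> \<open>Failure of the inequality makes the form finite and both quasi-norms
        nonzero, which is what the finiteness of the masses needs.\<close>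
      proof (rule ccontr)
        assume "\<not> ?thesis"
        then have less: "HLS_form lam f g < ennreal (X / (2 * A * B))" by simp
        then have fin: "HLS_form lam f g < \<infinity>" by (rule order.strict_trans) simp
        have "X \<noteq> 0" using less by auto
        then have nz: "Lqnorm lebesgue p f \<noteq> 0" "Lqnorm (lebesgue_on half_space) r g \<noteq> 0"
          by (auto simp: X_def)
        from fin obtain i where i: "HLS_form lam f g = ennreal i" "i \<ge> 0"
          by (cases "HLS_form lam f g") auto
        with less have "i < X / (2 * A * B)" by (simp add: ennreal_less_iff)
        \<comment> \<open>A value strictly in between is positive even if \<open>i = 0\<close>, and
          still small enough to contradict \<open>main\<close>.\<close>
        then obtain J where J: "i < J" "J < X / (2 * A * B)" using dense by blast
        obtain F where F: "F \<ge> 0" "(\<integral>\<^sup>+x. ennreal (f x) \<partial>lebesgue) = ennreal F"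
          using nn_integral_boundary_finite[OF f g fin nz(2) lam0]
          by (cases "\<integral>\<^sup>+x. ennreal (f x) \<partial>lebesgue") auto
        obtain G where G: "G \<ge> 0" "(\<integral>\<^sup>+y. ennreal (g y) \<partial>lebesgue_on half_space) = ennreal G"
          using nn_integral_interior_finite[OF f g fin nz(1) lam0]
          by (cases "\<integral>\<^sup>+y. ennreal (g y) \<partial>lebesgue_on half_space") auto
        have "F \<noteq> 0"
        proof
          assume "F = 0"
          then have "AE x in lebesgue. ennreal (f x) = 0"
            using F f by (subst nn_integral_0_iff_AE[symmetric]) auto
          then have "AE x in lebesgue. f x = 0"
            by eventually_elim (use f in \<open>simp add: ennreal_eq_0_iff antisym\<close>)
          then show False using nz Lqnorm_eq_0 by blast
        qed
        moreover have "G \<noteq> 0"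
        proof
          assume "G = 0"
          then have "AE y in lebesgue_on half_space. ennreal (g y) = 0"
            using G g by (subst nn_integral_0_iff_AE[symmetric]) auto
          moreover have "AE y in lebesgue_on half_space. y \<in> half_space"
            by (rule AE_I2) (simp add: space_lebesgue_on_half_space)
          ultimately have "AE y in lebesgue_on half_space. g y = 0"
            by eventually_elim (use g in \<open>simp add: ennreal_eq_0_iff antisym\<close>)
          then show False using nz Lqnorm_eq_0 by blast
        qed
        ultimately have "X \<le> 2 * A * B * J"
          unfolding X_def using F G J i by (intro main[OF f g]) (auto intro: ennreal_leI)
        then show False using J AB by (simp add: field_simps)
      qed
      then show "ennreal (1 / (2 * A * B) * Lqnorm lebesgue p f * Lqnorm (lebesgue_on half_space) r g)
          \<le> HLS_form lam f g"
        by (simp add: X_def)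
    qed
  qed
qed

section \<open>Boundedness of the admissible constants and the best one\<close>

text \<open>One test pair suffices: for indicators of two unit balls the form is finite and both
  quasi-norms are positive, so their quotient bounds every admissible constant.\<close>

lemma bdd_above_reverse_HLS_constant:
  fixes lam p r :: real
  assumes lam: "lam > 0"
  shows "bdd_above {C. reverse_HLS_constant TYPE('m::finite) lam p r C}"
proof -
  define U where "U = cball (0 :: real^'m) 1"
  \<comment> \<open>Height 2 for the centre keeps the closed unit ball inside the open
    half-space.\<close>
  define W where "W = cball (0 :: real^'m, 2 :: real) 1"
  define f where "f = (indicator U :: real^'m \<Rightarrow> real)"
  define g where "g = (indicator W :: (real^'m) \<times> real \<Rightarrow> real)"
  have W: "W \<subseteq> half_space"
  proof
    fix y assume "y \<in> W"
    then have "\<bar>2 - snd y\<bar> \<le> 1"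
      using dist_snd_le[of "(0, 2)" y] by (simp add: W_def dist_real_def)
    then show "y \<in> half_space" by (simp add: half_space_def)
  qed
  have Wm: "W \<in> sets (lebesgue_on half_space)"
    using W by (auto simp: sets_restrict_space_iff half_space_lebesgue W_def Int_absorb1)
  have Um: "U \<in> sets lborel" "U \<in> sets lebesgue" by (simp_all add: U_def)
  have meW: "emeasure (lebesgue_on half_space) W = emeasure lborel W"
    using W half_space_lebesgue by (subst emeasure_restrict_space) (auto simp: W_def)
  have eW: "emeasure lborel W = ennreal (unit_ball_vol (real CARD('m) + 1))"
    using emeasure_cball[of 1 "(0 :: real^'m, 2 :: real)"] by (simp add: W_def add.commute)
  have eU: "emeasure lborel U = ennreal (unit_ball_vol (real CARD('m)))"
    using emeasure_cball[of 1 "0 :: real^'m"] by (simp add: U_def)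
  \<comment> \<open>In HOL \<open>0 powr p = 0\<close> for every real \<open>p\<close>, so powers
    leave indicators unchanged.\<close>
  have fp: "\<bar>f x\<bar> powr p = indicator U x" for x
    by (simp add: f_def split: split_indicator)
  have gp: "\<bar>g y\<bar> powr r = indicator W y" for y
    by (simp add: g_def split: split_indicator)
  have fL: "f \<in> Lspace lebesgue p"
    using Um eU by (simp add: Lspace_def fp ennreal_indicator)
      (auto simp: f_def intro!: borel_measurable_indicator sets_completionI_sets)
  have gL: "g \<in> Lspace (lebesgue_on half_space) r"
    using Wm eW meW by (simp add: Lspace_def gp ennreal_indicator) (simp add: g_def)
  have unit_ball_vol_neq_0: "unit_ball_vol t \<noteq> 0" if "t \<ge> 0" for t
    using unit_ball_vol_pos[OF that] by linarith
  have nf: "Lqnorm lebesgue p f > 0"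
  proof -
    have "measure lebesgue U = unit_ball_vol (real CARD('m))"
      using eU Um by (simp add: measure_def)
    then show ?thesis
      by (simp add: Lqnorm_def fp unit_ball_vol_neq_0)
  qed
  have ng: "Lqnorm (lebesgue_on half_space) r g > 0"
  proof -
    have "measure (lebesgue_on half_space) W = unit_ball_vol (real CARD('m) + 1)"
      using eW meW by (simp add: measure_def)
    then show ?thesis
      using W by (simp add: unit_ball_vol_neq_0 Lqnorm_def gp space_lebesgue_on_half_space Int_absorb2)
  qed
  \<comment> \<open>The 4 is \<open>1 + 2 + 1\<close>: from \<open>x\<close> to the origin, on to
    the centre of \<open>W\<close>, and from there to \<open>y\<close>.\<close>
  have pw: "f x * norm ((x, 0) - y) powr lam * g y \<le> 4 powr lam * indicator W y * indicator U x" for x y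
  proof (cases "x \<in> U \<and> y \<in> W")
    case True
    have "norm ((x, 0) - y) = dist (x, 0) y" by (simp add: dist_norm)
    also have "\<dots> \<le> dist (x, 0) (0 :: real^'m, 0 :: real) + dist (0, 0) (0 :: real^'m, 2 :: real) + dist (0, 2) y"
      using dist_triangle[of "(x, 0)" y "(0, 0)"] dist_triangle[of "(0, 0)" y "(0, 2)"] by linarith
    also have "\<dots> \<le> 1 + 2 + 1"
      using True by (intro add_mono) (auto simp: U_def W_def dist_Pair_Pair dist_norm)
    finally have "norm ((x, 0) - y) powr lam \<le> 4 powr lam"
      using lam by (intro powr_mono2) auto
    then show ?thesis using True by (simp add: f_def g_def)
  qed (auto simp: f_def g_def)
  have "HLS_form lam f g \<le> (\<integral>\<^sup>+y. (\<integral>\<^sup>+x. ennreal (4 powr lam) * indicator W y * indicator U x \<partial>lebesgue) \<partial>lebesgue_on half_space)"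
    unfolding HLS_form_def
  proof (intro nn_integral_mono)
    fix x y
    show "ennreal (f x * norm ((x, 0) - y) powr lam * g y) \<le> ennreal (4 powr lam) * indicator W y * indicator U x"
      using ennreal_leI[OF pw[of x y]] by (simp add: ennreal_neg split: split_indicator split_indicator_asm)
  qed
  also have "\<dots> = ennreal (4 powr lam) * emeasure lborel W * emeasure lborel U"
    using Um Wm by (simp add: nn_integral_cmult_indicator nn_integral_multc nn_integral_cmult meW)
  also have "\<dots> < \<infinity>" by (simp add: eU eW ennreal_mult_less_top)
  finally obtain i where i: "HLS_form lam f g = ennreal i" "i \<ge> 0"
    by (cases "HLS_form lam f g") auto
  have f0: "\<forall>x. f x \<ge> 0" and g0: "\<forall>y\<in>half_space. g y \<ge> 0"
    by (simp_all add: f_def g_def)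
  define P where "P = Lqnorm lebesgue p f * Lqnorm (lebesgue_on half_space) r g"
  have P: "P > 0" using nf ng by (simp add: P_def)
  show ?thesis
  proof (rule bdd_aboveI)
    fix C assume "C \<in> {C. reverse_HLS_constant TYPE('m) lam p r C}"
    then have "ennreal (C * Lqnorm lebesgue p f * Lqnorm (lebesgue_on half_space) r g) \<le> HLS_form lam f g"
      unfolding reverse_HLS_constant_def mem_Collect_eq using fL gL f0 g0 by blast
    then have "ennreal (C * P) \<le> ennreal i" by (simp only: i P_def mult.assoc)
    then have "C * P \<le> i" using i by (simp add: ennreal_le_iff)
    then show "C \<le> i / P" using P by (simp add: field_simps)
  qed
qed

text \<open>For fixed functions with finite form the inequality is a linear upper bound on the
  constant, and such bounds pass to the supremum. An infinite form or a vanishing product of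
  quasi-norms is trivial.\<close>

lemma reverse_HLS_constant_Sup:
  fixes lam p r :: real
  assumes ne: "reverse_HLS_constant TYPE('m::finite) lam p r C0"
    and bdd: "bdd_above {C. reverse_HLS_constant TYPE('m) lam p r C}"
  shows "reverse_HLS_constant TYPE('m) lam p r (Sup {C. reverse_HLS_constant TYPE('m) lam p r C})"
  \<comment> \<open>The instantiation unfolds only the outer occurrence and leaves the set under
    \<open>Sup\<close> folded.\<close>
  unfolding reverse_HLS_constant_def[of lam p r "Sup _"]
proof (intro ballI impI)
  fix f :: "real^'m \<Rightarrow> real" and g :: "(real^'m) \<times> real \<Rightarrow> real"
  assume fg: "f \<in> Lspace lebesgue p" "g \<in> Lspace (lebesgue_on half_space) r"
    "\<forall>x. f x \<ge> 0" "\<forall>y\<in>half_space. g y \<ge> 0"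
  define P where "P = Lqnorm lebesgue p f * Lqnorm (lebesgue_on half_space) r g"
  let ?S = "{C. reverse_HLS_constant TYPE('m) lam p r C}"
  have le: "ennreal (C * P) \<le> HLS_form lam f g" if "C \<in> ?S" for C
    using that fg by (auto simp: reverse_HLS_constant_def P_def mult.assoc)
  have "ennreal (Sup ?S * P) \<le> HLS_form lam f g"
  proof (cases "HLS_form lam f g")
    case (real i)
    have "P \<ge> 0" by (simp add: P_def Lqnorm_nonneg)
    have le': "C * P \<le> i" if "C \<in> ?S" for C
      using le[OF that] real by (simp add: ennreal_le_iff)
    have "Sup ?S * P \<le> i"
    proof (cases "P = 0")
      case False
      then have "P > 0" using \<open>P \<ge> 0\<close> by simp
      have "Sup ?S \<le> i / P"
        using ne le' \<open>P > 0\<close> by (intro cSup_least) (auto simp: field_simps)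
      then show ?thesis using \<open>P > 0\<close> by (simp add: field_simps)
    qed (use real in simp)
    then show ?thesis using real by (simp add: ennreal_leI)
  qed simp
  then show "ennreal (Sup ?S * Lqnorm lebesgue p f * Lqnorm (lebesgue_on half_space) r g) \<le> HLS_form lam f g"
    by (simp add: P_def mult.assoc)
qed

text \<open>Quantifying \<open>C\<close> before \<open>r\<close> expresses that it depends on
  \<open>n\<close>, \<open>lam\<close> and \<open>p\<close> alone. This is possible because the
  scaling condition determines \<open>1 / r\<close>.\<close>

theorem theorem3:
  fixes n :: nat and lam p :: real
  assumes "n \<ge> 2" and "CARD('m::finite) = n - 1"
    and "lam > 0" and "0 < p" and "p < 1"
  shows "\<exists>C>0. \<forall>r::real. 0 < r \<longrightarrow> r < 1 \<longrightarrow>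
           (real n - 1) / real n * (1 / p) + 1 / r - lam / real n = 2 - 1 / real n \<longrightarrow>
           reverse_HLS_constant TYPE('m) lam p r C \<and>
           (\<forall>C'. reverse_HLS_constant TYPE('m) lam p r C' \<longrightarrow> C' \<le> C)"
proof -
  define admissible where "admissible r \<longleftrightarrow> 0 < r \<and> r < 1 \<and>
    (real n - 1) / real n * (1 / p) + 1 / r - lam / real n = 2 - 1 / real n" for r :: real
  have uniq: "r = r'" if "admissible r" "admissible r'" for r r'
  proof -
    have "1 / r = 1 / r'" using that unfolding admissible_def by linarith
    then show ?thesis by simp
  qed
  show ?thesis
  proof (cases "\<exists>r. admissible r")
    case False
    \<comment> \<open>Without an admissible \<open>r\<close> the claim is vacuous, and any positive
      constant serves.\<close>
    then show ?thesis by (intro exI[of _ 1]) (auto simp: admissible_def)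
  next
    case True
    then obtain r where adm: "admissible r" by blast
    then have r: "0 < r" "r < 1"
      and eq: "(real n - 1) / real n * (1 / p) + 1 / r - lam / real n = 2 - 1 / real n"
      by (auto simp: admissible_def)
    have n: "real n = real CARD('m) + 1" using assms by simp
    \<comment> \<open>Multiplying the scaling condition by \<open>n\<close> and collecting terms
      leads to the form used for existence.\<close>
    have "(real n - 1) * (1 / p) + real n * (1 / r) - lam
        = real n * ((real n - 1) / real n * (1 / p) + 1 / r - lam / real n)"
      using assms(1) unfolding distrib_left right_diff_distrib by simp
    also have "\<dots> = 2 * real n - 1"
      unfolding eq using assms(1) by (simp add: right_diff_distrib)
    finally have "(real n - 1) * (1 / p) + real n * (1 / r) - lam = 2 * real n - 1" .
    then have "real CARD('m) * (1 / p - 1) + (real CARD('m) + 1) * (1 / r - 1) = lam"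
      unfolding n by (simp add: algebra_simps)
    from reverse_HLS_constant_exists[OF assms(4,5) r this] obtain C0
      where C0: "C0 > 0" "reverse_HLS_constant TYPE('m) lam p r C0" by blast
    let ?S = "{C. reverse_HLS_constant TYPE('m) lam p r C}"
    have bdd: "bdd_above ?S"
      using assms(3) by (rule bdd_above_reverse_HLS_constant)
    have max: "C \<le> Sup ?S" if "reverse_HLS_constant TYPE('m) lam p r C" for C
      using that by (intro cSup_upper bdd) auto
    show ?thesis
    proof (intro exI[of _ "Sup ?S"] conjI allI impI)
      show "Sup ?S > 0" using max[OF C0(2)] C0(1) by simp
    next
      fix r' :: real
      assume "0 < r'" "r' < 1" "(real n - 1) / real n * (1 / p) + 1 / r' - lam / real n = 2 - 1 / real n"
      then have [simp]: "r' = r" using uniq[OF adm] by (simp add: admissible_def)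
      show "reverse_HLS_constant TYPE('m) lam p r' (Sup ?S)"
        using reverse_HLS_constant_Sup[OF C0(2) bdd] by simp
      show "C' \<le> Sup ?S" if "reverse_HLS_constant TYPE('m) lam p r' C'" for C'
        using that by (intro max) simp
    qed
  qed
qed

end
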